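(* Let $G=(V,E,w)$ be a strongly connected weighted digraph with $m$ edges, unweighted diameter $d$ and weights in $[-w_{\max},w_{\max}]$; let $\varepsilon>0$, $\eta=(2.5\log m)/\varepsilon$, and $\delta\le\varepsilon/(16w_{\max}d)$. Let $x\in\mathbb{R}^n$ be such that $\mathrm{diag}(e^x)$ solves the approximate Matrix Balancing problem on $K=\exp[-\eta W]$ to accuracy $\delta$, and let $A=\mathrm{diag}(e^x)K\mathrm{diag}(e^{-x})$. Then $P=A/\sum_{ij}A_{ij}$ satisfies $P\in\Delta_E$, $\|P\mathbf{1}-P^T\mathbf{1}\|_1\le\delta$, and $\langle P,W\rangle\le\mu(G)+\varepsilon/2$.
   Context: Vertices are identified with $[n]$. $W_{ij}=w(i,j)$ for $(i,j)\in E$ and $W_{ij}=\infty$ otherwise; $\exp[\cdot]$ is entrywise with $e^{-\infty}=0$. $\langle P,W\rangle=\sum_{(i,j)\in E}P_{ij}W_{ij}$. $\Delta_E=\{P\in\mathbb{R}_{\ge0}^{n\times n}:\sum_{ij}P_{ij}=1,\ \mathrm{supp}(P)\subseteq E\}$. A nonnegative matrix $A$ is $\delta$-balanced if $\|A\mathbf{1}-A^T\mathbf{1}\|_1/\sum_{ij}A_{ij}\le\delta$. For $K\in\mathbb{R}_{\ge0}^{n\times n}$ and $\delta>0$, a positive diagonal matrix $D$ solves the approximate Matrix Balancing problem on $K$ to accuracy $\delta$ if $A=DKD^{-1}$ is $\delta$-balanced and $\sum_{ij}A_{ij}\le\sum_{ij}K_{ij}$. $\mu(G)$ is the minimum over directed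 cycles $\sigma$ of $\frac1{|\sigma|}\sum_{e\in\sigma}w(e)$; $d$ is the maximum over ordered vertex pairs of the number of edges on a shortest directed path. *)

theory Defs
  imports "HOL-Analysis.Analysis" "Graph_Theory.Graph_Theory"
begin

text \<open>
  A weighted digraph on the vertices \<open>[n]\<close> is a \<^typ>\<open>'n pair_pre_digraph\<close> \<open>G\<close> with
  \<open>pverts G = UNIV\<close> over a finite type \<open>'n\<close>, together with a weight function on pairs, of which
  only the values on the edges \<open>parcs G\<close> matter. Loops are allowed.
\<close>

definition cycle_mean :: "('n \<times> 'n \<Rightarrow> real) \<Rightarrow> ('n \<times> 'n) list \<Rightarrow> real" where
  "cycle_mean w p = (\<Sum>e\<leftarrow>p. w e) / real (length p)"

definition min_mean_cycle :: "'n pair_pre_digraph \<Rightarrow> ('n \<times> 'n \<Rightarrow> real) \<Rightarrow> real" where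
  "min_mean_cycle G w = Min {cycle_mean w p | p. pre_digraph.cycle (with_proj G) p}"

definition hop_dist :: "'n pair_pre_digraph \<Rightarrow> 'n \<Rightarrow> 'n \<Rightarrow> nat" where
  "hop_dist G u v = Min {length p | p. pre_digraph.apath (with_proj G) u p v}"

definition hop_diameter :: "'n pair_pre_digraph \<Rightarrow> nat" where
  "hop_diameter G = Max {hop_dist G u v | u v. u \<in> pverts G \<and> v \<in> pverts G}"

definition weight_matrix ::
    "'n::finite pair_pre_digraph \<Rightarrow> ('n \<times> 'n \<Rightarrow> real) \<Rightarrow> ereal ^ 'n ^ 'n" where
  "weight_matrix G w = (\<chi> i j. if (i, j) \<in> parcs G then ereal (w (i, j)) else \<infinity>)"

text \<open>
  The exponential on the extended reals, with \<open>exp (-\<infinity>) = 0\<close>. The value at \<open>+\<infinity>\<close> is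
  a placeholder: the entries of \<open>-\<eta>W\<close> with \<open>\<eta> \<ge> 0\<close> are never \<open>+\<infinity>\<close>.
\<close>

definition exp_ext :: "ereal \<Rightarrow> real" where
  "exp_ext a = (if a = -\<infinity> then 0 else exp (real_of_ereal a))"

definition gibbs_kernel ::
    "real \<Rightarrow> ereal ^ 'n::finite ^ 'n \<Rightarrow> real ^ 'n ^ 'n" where
  "gibbs_kernel \<eta> W = map_matrix (\<lambda>a. exp_ext (- ereal \<eta> * a)) W"

text \<open>The restriction to edges matters: off the edges \<^const>\<open>real_of_ereal\<close> sends \<open>\<infinity>\<close> to \<open>0\<close>.\<close>

definition edge_inner ::
    "'n::finite pair_pre_digraph \<Rightarrow> real ^ 'n ^ 'n \<Rightarrow> ereal ^ 'n ^ 'n \<Rightarrow> real" where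
  "edge_inner G P W = (\<Sum>(i, j)\<in>parcs G. P $ i $ j * real_of_ereal (W $ i $ j))"

definition entry_sum :: "real ^ 'n::finite ^ 'n \<Rightarrow> real" where
  "entry_sum A = (\<Sum>i\<in>UNIV. \<Sum>j\<in>UNIV. A $ i $ j)"

definition nonneg_matrix :: "real ^ 'n::finite ^ 'n \<Rightarrow> bool" where
  "nonneg_matrix A \<longleftrightarrow> (\<forall>i j. 0 \<le> A $ i $ j)"

definition matrix_support :: "real ^ 'n::finite ^ 'n \<Rightarrow> ('n \<times> 'n) set" where
  "matrix_support P = {(i, j). P $ i $ j \<noteq> 0}"

definition edge_simplex :: "'n::finite pair_pre_digraph \<Rightarrow> (real ^ 'n ^ 'n) set" where
  "edge_simplex G = {P. nonneg_matrix P \<and> entry_sum P = 1 \<and> matrix_support P \<subseteq> parcs G}"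

definition norm1 :: "real ^ 'n::finite \<Rightarrow> real" where
  "norm1 v = (\<Sum>i\<in>UNIV. \<bar>v $ i\<bar>)"

text \<open>
  \<open>\<parallel>A\<one> - A\<^sup>T\<one>\<parallel>\<^sub>1\<close>; here \<open>1 :: real ^ 'n\<close> is the all-ones vector.
\<close>

definition imbalance :: "real ^ 'n::finite ^ 'n \<Rightarrow> real" where
  "imbalance A = norm1 (A *v 1 - Finite_Cartesian_Product.transpose A *v 1)"

definition balanced :: "real \<Rightarrow> real ^ 'n::finite ^ 'n \<Rightarrow> bool" where
  "balanced \<delta> A \<longleftrightarrow> nonneg_matrix A \<and> imbalance A / entry_sum A \<le> \<delta>"

definition positive_diagonal :: "real ^ 'n::finite ^ 'n \<Rightarrow> bool" where
  "positive_diagonal D \<longleftrightarrow> (\<forall>i j. i \<noteq> j \<longrightarrow> D $ i $ j = 0) \<and> (\<forall>i. 0 < D $ i $ i)"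

definition solves_matrix_balancing ::
    "real ^ 'n::finite ^ 'n \<Rightarrow> real \<Rightarrow> real ^ 'n ^ 'n \<Rightarrow> bool" where
  "solves_matrix_balancing K \<delta> D \<longleftrightarrow>
     positive_diagonal D \<and>
     balanced \<delta> (D ** K ** matrix_inv D) \<and>
     entry_sum (D ** K ** matrix_inv D) \<le> entry_sum K"

definition diag_mat :: "real ^ 'n::finite \<Rightarrow> real ^ 'n ^ 'n" where
  "diag_mat v = (\<chi> i j. if i = j then v $ i else 0)"

definition exp_vec :: "real ^ 'n::finite \<Rightarrow> real ^ 'n" where
  "exp_vec x = (\<chi> i. exp (x $ i))"

end

theory Submission
  imports Defs
begin

text \<open>
  Write \<open>s\<close> for the entry sum of \<open>A\<close>. Taking logarithms of the entries of \<open>P\<close> expresses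
  \<open>\<eta>\<langle>P, W\<rangle>\<close> as the entropy of \<open>P\<close>, minus \<open>ln s\<close>, plus the pairing of \<open>x\<close> with the imbalance
  vector of \<open>P\<close>. The entropy is at most \<open>ln m\<close>. The potentials \<open>x\<close> cancel along a cycle, and
  every entry of \<open>A\<close> is at most \<open>s\<close>, so \<open>ln s \<ge> -\<eta>\<mu>\<close>. The same entrywise bound, summed along a
  shortest path, bounds the oscillation of \<open>x\<close> by \<open>d (ln s + \<eta> w\<^sub>m\<^sub>a\<^sub>x)\<close>; keeping \<open>ln s\<close> here
  lets it be absorbed by the term \<open>-ln s\<close>. The remaining cases, \<open>\<epsilon> \<ge> 4 w\<^sub>m\<^sub>a\<^sub>x\<close> and \<open>m = 1\<close>
  (where \<open>\<eta> = 0\<close>), are immediate.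
\<close>

section \<open>Walks, cycles and diameter\<close>

context pair_wf_digraph
begin

text \<open>Telescoping: every intermediate vertex cancels. On a closed walk nothing remains, which
  is how potentials drop out of cycle means.\<close>

lemma sum_list_potential_awalk:
  fixes x :: "'a \<Rightarrow> real"
  assumes "awalk u p v"
  shows "(\<Sum>e\<leftarrow>p. x (fst e) - x (snd e)) = x u - x v"
  using assms by (induction p arbitrary: u) (auto simp: awalk_simps)

end

context pair_fin_digraph
begin

lemma finite_cycles: "finite {p. cycle p}"
proof (rule finite_subset)
  show "{p. cycle p} \<subseteq> {p. distinct p \<and> set p \<subseteq> parcs G}"
    by (auto simp: cycle_conv)
  show "finite {p. distinct p \<and> set p \<subseteq> parcs G}"
    using finite_subset_distinct[OF pair_finite_arcs] by (simp add: conj_commute)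
qed

text \<open>\<open>Min\<close> is informative only on a finite nonempty set. Nonemptiness holds
  because strong connectivity closes any arc into a closed walk, and a closed walk contains a
  cycle.\<close>

lemma min_mean_cycle_attained:
  assumes "strongly_connected (with_proj G)" "parcs G \<noteq> {}"
  obtains p where "cycle p" "min_mean_cycle G w = cycle_mean w p"
proof -
  obtain u v where uv: "(u, v) \<in> parcs G"
    using assms(2) by auto
  hence "v \<rightarrow>\<^sup>*\<^bsub>with_proj G\<^esub> u"
    using assms(1) wellformed' by (auto simp: strongly_connected_def)
  then obtain q where "awalk v q u"
    using reachable_awalk by auto
  hence "awalk u ((u, v) # q) u"
    using uv by (simp add: awalk_Cons_iff)
  hence "closed_w ((u, v) # q)"
    by (auto simp: closed_w_def)
  hence "\<exists>p. cycle p"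
    by (rule closed_w_imp_cycle)
  hence "{cycle_mean w p | p. cycle p} \<noteq> {}"
    by auto
  moreover have "finite {cycle_mean w p | p. cycle p}"
    using finite_cycles by simp
  ultimately have "min_mean_cycle G w \<in> {cycle_mean w p | p. cycle p}"
    unfolding min_mean_cycle_def by (intro Min_in)
  thus ?thesis
    using that by auto
qed

lemma awalk_within_hop_diameter:
  assumes "strongly_connected (with_proj G)" "u \<in> pverts G" "v \<in> pverts G"
  obtains p where "awalk u p v" "length p \<le> hop_diameter G"
proof -
  have "u \<rightarrow>\<^sup>*\<^bsub>with_proj G\<^esub> v"
    using assms by (auto simp: strongly_connected_def)
  hence "{length p | p. apath u p v} \<noteq> {}"
    using reachable_apath by auto
  moreover have "finite {length p | p. apath u p v}"
    using apaths_finite[of u v] by simp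
  ultimately have "hop_dist G u v \<in> {length p | p. apath u p v}"
    unfolding hop_dist_def by (intro Min_in)
  then obtain p where p: "apath u p v" "hop_dist G u v = length p"
    by auto
  have "{hop_dist G u v | u v. u \<in> pverts G \<and> v \<in> pverts G}
      = (\<lambda>(u, v). hop_dist G u v) ` (pverts G \<times> pverts G)"
    by auto
  hence "finite {hop_dist G u v | u v. u \<in> pverts G \<and> v \<in> pverts G}"
    using pair_finite_verts by simp
  hence "hop_dist G u v \<le> hop_diameter G"
    unfolding hop_diameter_def using assms(2,3) by (intro Max_ge) auto
  thus ?thesis
    using that[OF awalkI_apath[OF p(1)]] p(2) by simp
qed

text \<open>Telescope along a shortest path. Nonnegativity of \<open>b\<close> lets the actual path
  length be replaced by the diameter.\<close>

lemma oscillation_le_hop_diameter: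
  fixes x :: "'a \<Rightarrow> real"
  assumes "strongly_connected (with_proj G)" "u \<in> pverts G" "v \<in> pverts G"
    and "\<And>i j. (i, j) \<in> parcs G \<Longrightarrow> x i - x j \<le> b" and "0 \<le> b"
  shows "x u - x v \<le> real (hop_diameter G) * b"
proof -
  obtain p where p: "awalk u p v" "length p \<le> hop_diameter G"
    using awalk_within_hop_diameter assms(1-3) by blast
  have "x u - x v = (\<Sum>e\<leftarrow>p. x (fst e) - x (snd e))"
    using sum_list_potential_awalk[OF p(1)] by simp
  also have "\<dots> \<le> (\<Sum>e\<leftarrow>p. b)"
    using p(1) assms(4) by (intro sum_list_mono) (auto simp: awalk_def)
  also have "\<dots> = real (length p) * b"
    by (simp add: sum_list_triv)
  also have "\<dots> \<le> real (hop_diameter G) * b"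
    using p(2) assms(5) by (intro mult_right_mono) auto
  finally show ?thesis .
qed

text \<open>A single arc can connect strongly only one vertex carrying a loop. This rules out
  off-edge entries in the degenerate case \<open>\<eta> = 0\<close>.\<close>

lemma single_arc_complete:
  assumes "strongly_connected (with_proj G)" "card (parcs G) = 1" "u \<in> pverts G" "v \<in> pverts G"
  shows "(u, v) \<in> parcs G"
proof -
  obtain a b where ab: "parcs G = {(a, b)}"
    using assms(2) by (auto simp: card_1_singleton_iff)
  \<comment> \<open>A walk between distinct vertices is nonempty and must start with the only arc.
    Using this in both directions makes both endpoints equal to \<open>a\<close>.\<close>
  have tail: "u' = a" if "u' \<in> pverts G" "v' \<in> pverts G" "u' \<noteq> v'" for u' v'
  proof -
    obtain p where "awalk u' p v'"
      using awalk_within_hop_diameter assms(1) \<open>u' \<in> pverts G\<close> \<open>v' \<in> pverts G\<close> by blast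
    thus ?thesis
      using \<open>u' \<noteq> v'\<close> ab by (cases p) (auto simp: awalk_simps)
  qed
  have "a \<in> pverts G" "b \<in> pverts G"
    using ab wellformed' by auto
  hence "u' = v'" if "u' \<in> pverts G" "v' \<in> pverts G" for u' v'
    using tail that by metis
  thus ?thesis
    using ab assms(3,4) \<open>a \<in> pverts G\<close> \<open>b \<in> pverts G\<close> by auto
qed

text \<open>Summing the arcwise bound around the cycle removes \<open>x\<close>. The factor
  \<open>c\<close> is free so that \<open>\<eta>\<close> bounds \<open>ln s\<close>, while
  \<open>1\<close> and \<open>-1\<close> with zero potential bound the mean from below and
  above.\<close>

lemma cycle_mean_ge:
  fixes x :: "'a \<Rightarrow> real"
  assumes "cycle p" and "\<And>i j. (i, j) \<in> parcs G \<Longrightarrow> x i - x j + b \<le> c * w (i, j)"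
  shows "b \<le> c * cycle_mean w p"
proof -
  obtain u where u: "awalk u p u" "p \<noteq> []"
    using assms(1) by (auto simp: cycle_def)
  have "(\<Sum>e\<leftarrow>p. x (fst e) - x (snd e) + b) \<le> (\<Sum>e\<leftarrow>p. c * w e)"
    using u(1) assms(2) by (intro sum_list_mono) (auto simp: awalk_def)
  hence "real (length p) * b \<le> c * (\<Sum>e\<leftarrow>p. w e)"
    using sum_list_potential_awalk[OF u(1)]
    by (simp add: sum_list_addf sum_list_triv sum_list_const_mult)
  thus ?thesis
    using u(2) by (simp add: cycle_mean_def field_simps)
qed

end

section \<open>Entropy and imbalance\<close>

text \<open>Gibbs' inequality against the uniform distribution, obtained termwise from
  \<open>ln z \<le> z - 1\<close>.\<close>

lemma entropy_le_ln_card: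
  fixes p :: "'a \<Rightarrow> real"
  assumes "finite S" "sum p S = 1" "\<And>e. e \<in> S \<Longrightarrow> 0 < p e"
  shows "- (\<Sum>e\<in>S. p e * ln (p e)) \<le> ln (real (card S))"
proof -
  let ?m = "real (card S)"
  have m: "0 < ?m"
    using assms(1,2) by (auto simp: card_gt_0_iff)
  have "- (p e * ln (p e)) - p e * ln ?m \<le> 1 / ?m - p e" if e: "e \<in> S" for e
  proof -
    have "- ln (p e) - ln ?m = ln (1 / (?m * p e))"
      using m assms(3)[OF e] by (simp add: ln_div ln_mult)
    also have "\<dots> \<le> 1 / (?m * p e) - 1"
      using m assms(3)[OF e] by (intro ln_le_minus_one) simp
    finally have "p e * (- ln (p e) - ln ?m) \<le> p e * (1 / (?m * p e) - 1)"
      using assms(3)[OF e] by (intro mult_left_mono) auto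
    also have "\<dots> = 1 / ?m - p e"
      using assms(3)[OF e] by (simp add: right_diff_distrib)
    finally show ?thesis
      by (simp add: right_diff_distrib)
  qed
  hence "(\<Sum>e\<in>S. - (p e * ln (p e)) - p e * ln ?m) \<le> (\<Sum>e\<in>S. 1 / ?m - p e)"
    by (rule sum_mono)
  moreover have "(\<Sum>e\<in>S. - (p e * ln (p e)) - p e * ln ?m) = - (\<Sum>e\<in>S. p e * ln (p e)) - ln ?m"
    using assms(2) by (simp add: sum_subtractf sum_negf flip: sum_distrib_right)
  moreover have "(\<Sum>e\<in>S. 1 / ?m - p e) = 0"
    using assms(2) m by (simp add: sum_subtractf)
  ultimately show ?thesis
    by linarith
qed

text \<open>As \<open>v\<close> sums to zero, \<open>x\<close> may be shifted by a constant. All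
  values of \<open>x\<close> lie in \<open>[M - R, M]\<close>, so centering at the midpoint
  \<open>c\<close> leaves absolute values at most \<open>R / 2\<close>; this saves a factor of
  two.\<close>

lemma sum_mult_le_half_oscillation:
  fixes x v :: "'a::finite \<Rightarrow> real"
  assumes "sum v UNIV = 0" "\<And>i j. x i - x j \<le> R"
  shows "(\<Sum>i\<in>UNIV. x i * v i) \<le> R / 2 * (\<Sum>i\<in>UNIV. \<bar>v i\<bar>)"
proof -
  define M where "M = Max (range x)"
  define c where "c = M - R / 2"
  obtain i where i: "x i = M"
    using Max_in[of "range x"] by (metis M_def UNIV_not_empty finite finite_imageI image_iff image_is_empty)
  have "x j \<le> M" for j
    by (simp add: M_def)
  hence "\<bar>x j - c\<bar> \<le> R / 2" for j
    using assms(2)[of i j] i by (simp add: c_def abs_le_iff field_simps)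
  hence "(x j - c) * v j \<le> R / 2 * \<bar>v j\<bar>" for j
    by (metis abs_ge_self abs_ge_zero abs_mult mult_right_mono order.trans)
  hence "(\<Sum>j\<in>UNIV. (x j - c) * v j) \<le> (\<Sum>j\<in>UNIV. R / 2 * \<bar>v j\<bar>)"
    by (rule sum_mono)
  moreover have "(\<Sum>j\<in>UNIV. (x j - c) * v j) = (\<Sum>i\<in>UNIV. x i * v i)"
    using assms(1) by (simp add: left_diff_distrib sum_subtractf flip: sum_distrib_left)
  ultimately show ?thesis
    by (simp add: sum_distrib_left)
qed

lemma imbalance_eq:
  "imbalance A = (\<Sum>i\<in>UNIV. \<bar>(\<Sum>j\<in>UNIV. A $ i $ j) - (\<Sum>j\<in>UNIV. A $ j $ i)\<bar>)"
  by (simp add: imbalance_def norm1_def matrix_vector_mult_def transpose_def)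

lemma imbalance_scaleR: "imbalance (c *\<^sub>R A) = \<bar>c\<bar> * imbalance A"
  by (simp add: imbalance_eq abs_mult flip: sum_distrib_left right_diff_distrib)

text \<open>Summation by parts turns differences of \<open>x\<close> into a pairing of
  \<open>x\<close> with the net outflow \<open>v\<close>, whose total is zero.\<close>

lemma potential_pairing_le_imbalance:
  fixes P :: "real ^ 'n::finite ^ 'n"
  assumes "\<And>i j. x i - x j \<le> R"
  shows "(\<Sum>i\<in>UNIV. \<Sum>j\<in>UNIV. P $ i $ j * (x i - x j)) \<le> R / 2 * imbalance P"
proof -
  define v where "v i = (\<Sum>j\<in>UNIV. P $ i $ j) - (\<Sum>j\<in>UNIV. P $ j $ i)" for i
  have swap: "(\<Sum>i\<in>UNIV. \<Sum>j\<in>UNIV. P $ j $ i * y i) = (\<Sum>i\<in>UNIV. \<Sum>j\<in>UNIV. P $ i $ j * y j)"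
    for y :: "'n \<Rightarrow> real"
    by (rule sum.swap)
  have "sum v UNIV = 0"
    using swap[of "\<lambda>_. 1"] by (simp add: v_def sum_subtractf)
  moreover have "(\<Sum>i\<in>UNIV. \<Sum>j\<in>UNIV. P $ i $ j * (x i - x j)) = (\<Sum>i\<in>UNIV. x i * v i)"
    using swap[of x]
    by (simp add: v_def right_diff_distrib sum_subtractf sum_distrib_left mult.commute)
  ultimately show ?thesis
    using sum_mult_le_half_oscillation[of v x R] assms by (simp add: imbalance_eq v_def)
qed

section \<open>Diagonal scaling of the Gibbs kernel\<close>

lemma diag_mat_scaling_nth:
  "(diag_mat u ** K ** diag_mat v) $ i $ j = u $ i * K $ i $ j * v $ j"
  by (simp add: matrix_matrix_mult_def diag_mat_def if_distrib if_distribR cong: if_cong)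

text \<open>Since \<open>matrix_inv\<close> is defined by choice, its value is identified through
  uniqueness of inverses.\<close>

lemma matrix_inv_diag_mat_exp_vec:
  "matrix_inv (diag_mat (exp_vec x)) = diag_mat (exp_vec (- x))"
proof -
  have inv: "diag_mat (exp_vec y) ** diag_mat (exp_vec (- y)) = mat 1" for y :: "real ^ 'a"
    using diag_mat_scaling_nth[of "exp_vec y" "mat 1" "exp_vec (- y)"]
    unfolding matrix_mul_rid by (simp add: vec_eq_iff exp_vec_def mat_def exp_minus_inverse)
  hence "invertible (diag_mat (exp_vec x))"
    unfolding invertible_def using inv[of x] inv[of "- x"] by auto
  hence "matrix_inv (diag_mat (exp_vec x)) ** diag_mat (exp_vec x) = mat 1"
    unfolding invertible_def matrix_inv_def by (rule someI2_ex) simp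
  hence "matrix_inv (diag_mat (exp_vec x)) ** diag_mat (exp_vec x) ** diag_mat (exp_vec (- x))
       = diag_mat (exp_vec (- x))"
    by simp
  thus ?thesis
    unfolding matrix_mul_assoc[symmetric] inv matrix_mul_rid .
qed

text \<open>In \<open>ereal\<close>, \<open>0 * \<infinity> = 0\<close>, so at
  \<open>\<eta> = 0\<close> an off-edge entry would be 1 instead of 0; the second assumption
  excludes this.\<close>

lemma gibbs_kernel_weight_matrix_nth:
  assumes "0 \<le> \<eta>" "\<eta> = 0 \<Longrightarrow> (i, j) \<in> parcs G"
  shows "gibbs_kernel \<eta> (weight_matrix G w) $ i $ j
       = (if (i, j) \<in> parcs G then exp (- \<eta> * w (i, j)) else 0)"
  using assms by (auto simp: gibbs_kernel_def map_matrix_def weight_matrix_def exp_ext_def)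

lemma sum_entries_eq_sum_support:
  fixes M :: "real ^ 'n::finite ^ 'n"
  assumes "matrix_support M \<subseteq> S"
  shows "(\<Sum>i\<in>UNIV. \<Sum>j\<in>UNIV. M $ i $ j * f i j) = (\<Sum>(i, j)\<in>S. M $ i $ j * f i j)"
proof -
  have "(\<Sum>i\<in>UNIV. \<Sum>j\<in>UNIV. M $ i $ j * f i j) = (\<Sum>(i, j)\<in>UNIV. M $ i $ j * f i j)"
    by (simp add: sum.cartesian_product)
  also have "\<dots> = (\<Sum>(i, j)\<in>S. M $ i $ j * f i j)"
    using assms by (intro sum.mono_neutral_right) (fastforce simp: matrix_support_def)+
  finally show ?thesis .
qed

theorem theorem5p9:
  fixes G :: "'n::finite pair_pre_digraph"
    and w :: "'n \<times> 'n \<Rightarrow> real"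
    and wmax \<epsilon> \<eta> \<delta> :: real
    and W :: "ereal ^ 'n ^ 'n"
    and K A P :: "real ^ 'n ^ 'n"
    and x :: "real ^ 'n"
  assumes "pair_fin_digraph G"
    and "pverts G = UNIV"
    and "parcs G \<noteq> {}"
    and "strongly_connected (with_proj G)"
    and "\<forall>e\<in>parcs G. w e \<in> {- wmax..wmax}"
    and "\<epsilon> > 0"
    and "\<eta> = (2.5 * ln (real (card (parcs G)))) / \<epsilon>"
    and "\<delta> > 0"
    and "wmax * real (hop_diameter G) > 0 \<Longrightarrow> \<delta> \<le> \<epsilon> / (16 * wmax * real (hop_diameter G))"
    and "W = weight_matrix G w"
    and "K = gibbs_kernel \<eta> W"
    and "solves_matrix_balancing K \<delta> (diag_mat (exp_vec x))"
    and "A = diag_mat (exp_vec x) ** K ** diag_mat (exp_vec (- x))"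
    and "P = (1 / entry_sum A) *\<^sub>R A"
  shows "P \<in> edge_simplex G \<and> imbalance P \<le> \<delta> \<and>
         edge_inner G P W \<le> min_mean_cycle G w + \<epsilon> / 2"
proof -
  interpret pair_fin_digraph G
    by fact
  define E where "E = parcs G"
  define m where "m = real (card E)"
  define s where "s = entry_sum A"
  define d where "d = real (hop_diameter G)"
  define \<mu> where "\<mu> = min_mean_cycle G w"
  have E: "finite E" "E \<noteq> {}"
    using assms(3) by (auto simp: E_def)
  hence m_ge: "1 \<le> m"
    by (simp add: m_def Suc_le_eq card_gt_0_iff)
  have eta_eq: "\<eta> = 2.5 * ln m / \<epsilon>"
    using assms(7) by (simp add: m_def E_def)
  hence eta_nonneg: "0 \<le> \<eta>"
    using m_ge assms(6) by simp
  have single: "card E = 1" if "\<eta> = 0"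
    using that m_ge assms(6) by (simp add: eta_eq m_def)
  have "\<eta> = 0 \<Longrightarrow> (i, j) \<in> E" for i j
    using single_arc_complete[OF assms(4)] single assms(2) by (simp add: E_def)
  hence A_nth: "A $ i $ j = (if (i, j) \<in> E then exp (x $ i - x $ j - \<eta> * w (i, j)) else 0)" for i j
    using eta_nonneg
    by (simp add: assms(10,11,13) diag_mat_scaling_nth gibbs_kernel_weight_matrix_nth exp_vec_def
        E_def flip: exp_add)
  have supp_A: "matrix_support A \<subseteq> E"
    by (auto simp: matrix_support_def A_nth split: if_splits)
  have s_sum: "s = (\<Sum>(i, j)\<in>E. A $ i $ j)"
    using sum_entries_eq_sum_support[OF supp_A, of "\<lambda>_ _. 1"] by (simp add: s_def entry_sum_def)
  have s_pos: "0 < s"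
    unfolding s_sum using E by (intro sum_pos) (auto simp: A_nth)
  have P_nth: "P $ i $ j = A $ i $ j / s" for i j
    by (simp add: assms(14) s_def)
  have P_pos: "0 < P $ i $ j" if "(i, j) \<in> E" for i j
    using that s_pos by (simp add: P_nth A_nth)
  have P_nonneg: "0 \<le> P $ i $ j" for i j
    using s_pos by (simp add: P_nth A_nth)
  have supp_P: "matrix_support P \<subseteq> E"
    using supp_A by (auto simp: matrix_support_def P_nth)
  have P_sum: "(\<Sum>(i, j)\<in>E. P $ i $ j) = 1"
    using s_pos by (simp add: P_nth case_prod_unfold s_sum flip: sum_divide_distrib)
  have P_simplex: "P \<in> edge_simplex G"
    using sum_entries_eq_sum_support[OF supp_P, of "\<lambda>_ _. 1"] P_sum supp_P P_nonneg
    by (simp add: edge_simplex_def nonneg_matrix_def entry_sum_def E_def)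
  have imb: "imbalance P \<le> \<delta>"
    using assms(12) s_pos
    by (simp add: solves_matrix_balancing_def balanced_def matrix_inv_diag_mat_exp_vec
        imbalance_scaleR assms(14) s_def flip: assms(13))
  have inner_eq: "edge_inner G P W = (\<Sum>(i, j)\<in>E. P $ i $ j * w (i, j))"
    unfolding edge_inner_def E_def
    by (rule sum.cong) (auto simp: assms(10) weight_matrix_def)
  have w_bounds: "- wmax \<le> w e" "w e \<le> wmax" if "e \<in> E" for e
    using assms(5) that by (auto simp: E_def)
  obtain \<sigma> where \<sigma>: "cycle \<sigma>" "\<mu> = cycle_mean w \<sigma>"
    using min_mean_cycle_attained[OF assms(4,3)] by (metis \<mu>_def)
  have mu_ge: "- wmax \<le> \<mu>"
    using cycle_mean_ge[OF \<sigma>(1), of "\<lambda>_. 0" "- wmax" 1 w] w_bounds(1) by (simp add: \<sigma>(2) E_def)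
  have inner_le: "edge_inner G P W \<le> c" if "\<And>e. e \<in> E \<Longrightarrow> w e \<le> c" for c
  proof -
    have "edge_inner G P W \<le> (\<Sum>(i, j)\<in>E. P $ i $ j * c)"
      unfolding inner_eq using that P_nonneg
      by (intro sum_mono) (auto intro!: mult_left_mono)
    thus ?thesis
      using P_sum by (simp add: case_prod_unfold flip: sum_distrib_right)
  qed
  have edge_le: "x $ i - x $ j - \<eta> * w (i, j) \<le> ln s" if "(i, j) \<in> E" for i j
  proof -
    have "case_prod (\<lambda>i j. A $ i $ j) (i, j) \<le> s"
      unfolding s_sum using E(1) that by (intro member_le_sum) (auto simp: A_nth)
    thus ?thesis
      using s_pos that by (simp add: A_nth ln_ge_iff)
  qed
  have "edge_inner G P W \<le> \<mu> + \<epsilon> / 2"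
  proof -
    \<comment> \<open>If \<open>4 * wmax \<le> \<epsilon>\<close>, the trivial gap
      \<open>2 * wmax\<close> between the inner product and \<open>\<mu>\<close> suffices. Otherwise
      \<open>wmax\<close> is positive and large enough to force \<open>t \<le> 1\<close>
      below.\<close>
    consider "\<eta> = 0" | "4 * wmax \<le> \<epsilon>" | "0 < \<eta>" "\<epsilon> < 4 * wmax"
      using eta_nonneg by linarith
    thus ?thesis
    proof cases
      case 1
      then obtain e where e: "E = {e}"
        using single by (auto simp: card_1_singleton_iff)
      have "w e \<le> \<mu>"
        using cycle_mean_ge[OF \<sigma>(1), of "\<lambda>_. 0" "w e" 1 w] e by (simp add: \<sigma>(2) E_def)
      thus ?thesis
        using inner_le[of "w e"] e assms(6) by simp
    next
      case 2
      thus ?thesis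
        using inner_le[of wmax] w_bounds(2) mu_ge by simp
    next
      case 3
      \<comment> \<open>The total weight of the oscillation bound: \<open>d\<close> from path
        lengths, \<open>\<delta>\<close> from the imbalance, one half from centering.\<close>
      define t where "t = \<delta> * d / 2"
      have wmax_pos: "0 < wmax"
        using 3(2) assms(6) by linarith
      have d_nonneg: "0 \<le> d"
        by (simp add: d_def)
      have t_nonneg: "0 \<le> t"
        using assms(8) by (simp add: t_def d_def)
      have t_wmax: "2 * (t * wmax) \<le> \<epsilon> / 16"
      proof (cases "d = 0")
        case False
        hence "0 < d"
          using d_nonneg by simp
        thus ?thesis
          using assms(9) wmax_pos by (simp add: t_def d_def field_simps)
      qed (use assms(6) in \<open>simp add: t_def\<close>)
      hence "t * wmax \<le> 1 * wmax"
        using 3(2) wmax_pos by linarith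
      hence t_le: "t \<le> 1"
        using wmax_pos by simp
      have ln_s: "- ln s \<le> \<eta> * \<mu>"
        unfolding \<sigma>(2) using edge_le
        by (intro cycle_mean_ge[OF \<sigma>(1), where x = "($) x"]) (force simp: E_def)
      have "\<eta> * - wmax \<le> \<eta> * - w e" if "e \<in> E" for e
        using w_bounds(2)[OF that] eta_nonneg by (intro mult_left_mono) auto
      hence edge_osc: "x $ i - x $ j \<le> ln s + \<eta> * wmax" if "(i, j) \<in> E" for i j
        using edge_le[OF that] that by fastforce
      have mu_le: "\<mu> \<le> wmax"
        using cycle_mean_ge[OF \<sigma>(1), of "\<lambda>_. 0" "- wmax" "-1" w] w_bounds(2)
        by (simp add: \<sigma>(2) E_def)
      hence "\<eta> * \<mu> \<le> \<eta> * wmax"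
        using eta_nonneg by (rule mult_left_mono)
      hence "0 \<le> ln s + \<eta> * wmax"
        using ln_s by linarith
      hence osc: "x $ i - x $ j \<le> d * (ln s + \<eta> * wmax)" for i j
        unfolding d_def using edge_osc assms(2)
        by (intro oscillation_le_hop_diameter[OF assms(4)]) (auto simp: E_def)
      have "(\<Sum>(i, j)\<in>E. P $ i $ j * (x $ i - x $ j)) \<le> d * (ln s + \<eta> * wmax) / 2 * imbalance P"
        using potential_pairing_le_imbalance[of "($) x", OF osc, of P]
        by (simp add: sum_entries_eq_sum_support[OF supp_P])
      also have "\<dots> \<le> d * (ln s + \<eta> * wmax) / 2 * \<delta>"
        using imb d_nonneg \<open>0 \<le> ln s + \<eta> * wmax\<close> by (intro mult_left_mono) auto
      finally have pairing: "(\<Sum>(i, j)\<in>E. P $ i $ j * (x $ i - x $ j)) \<le> t * (ln s + \<eta> * wmax)"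
        by (simp add: t_def mult_ac)
      have entropy: "- (\<Sum>(i, j)\<in>E. P $ i $ j * ln (P $ i $ j)) \<le> ln m"
        using entropy_le_ln_card[of E "\<lambda>(i, j). P $ i $ j"] E(1) P_sum P_pos
        by (auto simp: m_def case_prod_unfold)
      have "\<eta> * (P $ i $ j * w (i, j))
          = P $ i $ j * (x $ i - x $ j) - P $ i $ j * ln s - P $ i $ j * ln (P $ i $ j)"
        if "(i, j) \<in> E" for i j
      proof -
        have ln_P: "ln (P $ i $ j) = x $ i - x $ j - \<eta> * w (i, j) - ln s"
          using that s_pos by (simp add: P_nth A_nth ln_div)
        show ?thesis
          unfolding ln_P by (simp add: algebra_simps)
      qed
      hence "\<eta> * edge_inner G P W = (\<Sum>(i, j)\<in>E. P $ i $ j * (x $ i - x $ j) - P $ i $ j * ln s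
          - P $ i $ j * ln (P $ i $ j))"
        unfolding inner_eq sum_distrib_left by (intro sum.cong) auto
      also have "\<dots> = (\<Sum>(i, j)\<in>E. P $ i $ j * (x $ i - x $ j)) - ln s
          - (\<Sum>(i, j)\<in>E. P $ i $ j * ln (P $ i $ j))"
        using P_sum by (simp add: case_prod_unfold sum_subtractf flip: sum_distrib_right)
      \<comment> \<open>The \<open>t * ln s\<close> from the pairing merges with
        \<open>- ln s\<close>. Since \<open>t \<le> 1\<close>, the remaining coefficient is
        nonnegative and the bound \<open>ln_s\<close> can be inserted.\<close>
      also have "\<dots> \<le> ln m + (1 - t) * - ln s + t * (\<eta> * wmax)"
        using pairing entropy by (simp add: algebra_simps)
      also have "\<dots> \<le> ln m + (1 - t) * (\<eta> * \<mu>) + t * (\<eta> * wmax)"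
        using mult_left_mono[OF ln_s, of "1 - t"] t_le by simp
      also have "\<dots> = ln m + \<eta> * (\<mu> + t * (wmax - \<mu>))"
        by (simp add: algebra_simps)
      also have "\<dots> \<le> ln m + \<eta> * (\<mu> + t * (2 * wmax))"
        using mu_ge eta_nonneg t_nonneg by (intro add_left_mono mult_left_mono) auto
      also have "\<dots> \<le> ln m + \<eta> * (\<mu> + \<epsilon> / 16)"
        using t_wmax eta_nonneg by (intro add_left_mono mult_left_mono) auto
      \<comment> \<open>The choice of \<open>\<eta>\<close> gives
        \<open>ln m = 2 / 5 * \<eta> * \<epsilon>\<close>, and
        \<open>1 / 16 + 2 / 5 < 1 / 2\<close>.\<close>
      also have "\<dots> = \<eta> * (\<mu> + \<epsilon> / 16 + 2 / 5 * \<epsilon>)"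
        using assms(6) by (simp add: eta_eq field_simps)
      finally have "edge_inner G P W \<le> \<mu> + \<epsilon> / 16 + 2 / 5 * \<epsilon>"
        using 3(1) by simp
      thus ?thesis
        using assms(6) by linarith
    qed
  qed
  thus ?thesis
    using P_simplex imb by (simp add: \<mu>_def)
qed

end
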